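(* Let the $\equiv_\Gamma$-classes of a finite group $G$ be of sizes $k_1,\ldots,k_n$. Then $$\mathrm{Aut}(\Gamma(G))=\left(\mathrm{S}_{k_1}\times\cdots\times\mathrm{S}_{k_n}\right):\mathrm{Aut}(\overline{\Gamma}_{\mathrm w}(G)).$$
   Context: The generating graph $\Gamma(G)$ of a finite group $G$ has vertex set $G$, with $x$ and $y$ joined if and only if $\langle x,y\rangle=G$; by convention, if $G$ is cyclic then every generator of $G$ carries a loop. For $x,y\in G$, $x\equiv_\Gamma y$ means that $x$ and $y$ have the same set of neighbours in $\Gamma(G)$. The reduced generating graph $\overline{\Gamma}(G)$ has as vertices the $\equiv_\Gamma$-classes, two classes being joined if their vertices are joined in $\Gamma(G)$ (with a loop at a class whose elements carry loops). $\overline{\Gamma}_{\mathrm w}(G)$ is $\overline{\Gamma}(G)$ with each vertex weighted by the cardinality of the corresponding $\equiv_\Gamma$-class, and $\mathrm{Aut}(\overline{\Gamma}_{\mathrm w}(G))$ is the group of weight-preserving automorphisms of $\overline{\Gamma}(G)$. $\mathrm{S}_k$ is the symmetric group of degree $k$; $A:B$ denotes a split extension with normal subgroup $A$ and complement $B$; here $\mathrm{S}_{k_1}\times\cdots\times\mathrm{S}_{k_n}$ is the product of the symmetric groups on the $\equiv_\Gamma$-classes, and the complement induces $\mathrm{Aut}(\overline{\Gamma}_{\mathrm w}(G))$ on the set of classes. *)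

theory Defs
  imports "HOL-Algebra.Algebra" "Graph_Theory.Pair_Digraph"
begin

section \<open>Graphs, their automorphisms, and the reduced graph\<close>

text \<open>
  An undirected graph, loops allowed, is a symmetric \<^typ>\<open>'v pair_pre_digraph\<close>: the edge
  joining u and v is represented by the two arcs (u, v) and (v, u), a loop at v by (v, v).
\<close>

text \<open>As in \<^const>\<open>BijGroup\<close>, automorphisms are undefined outside the vertex set.\<close>

definition graph_aut_group :: "'v pair_pre_digraph \<Rightarrow> ('v \<Rightarrow> 'v) monoid" where
  "graph_aut_group \<Gamma> = (BijGroup (pverts \<Gamma>))
     \<lparr>carrier := {f \<in> Bij (pverts \<Gamma>). \<forall>u\<in>pverts \<Gamma>. \<forall>v\<in>pverts \<Gamma>.
                    (f u, f v) \<in> parcs \<Gamma> \<longleftrightarrow> (u, v) \<in> parcs \<Gamma>}\<rparr>"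

definition weighted_graph_aut_group ::
    "'v pair_pre_digraph \<Rightarrow> ('v \<Rightarrow> nat) \<Rightarrow> ('v \<Rightarrow> 'v) monoid" where
  "weighted_graph_aut_group \<Gamma> w = (graph_aut_group \<Gamma>)
     \<lparr>carrier := {f \<in> carrier (graph_aut_group \<Gamma>). \<forall>v\<in>pverts \<Gamma>. w (f v) = w v}\<rparr>"

definition neighbours :: "'v pair_pre_digraph \<Rightarrow> 'v \<Rightarrow> 'v set" where
  "neighbours \<Gamma> x = {y \<in> pverts \<Gamma>. (x, y) \<in> parcs \<Gamma>}"

definition same_neighbours :: "'v pair_pre_digraph \<Rightarrow> 'v rel" where
  "same_neighbours \<Gamma> =
     {(x, y). x \<in> pverts \<Gamma> \<and> y \<in> pverts \<Gamma> \<and> neighbours \<Gamma> x = neighbours \<Gamma> y}"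

definition neighbour_classes :: "'v pair_pre_digraph \<Rightarrow> 'v set set" where
  "neighbour_classes \<Gamma> = pverts \<Gamma> // same_neighbours \<Gamma>"

text \<open>Adjacency of classes does not depend on representatives; see \<open>reduced_graph_arc_iff\<close>.\<close>

definition reduced_graph :: "'v pair_pre_digraph \<Rightarrow> 'v set pair_pre_digraph" where
  "reduced_graph \<Gamma> =
     \<lparr>pverts = neighbour_classes \<Gamma>,
      parcs = {(C, D). C \<in> neighbour_classes \<Gamma> \<and> D \<in> neighbour_classes \<Gamma> \<and>
                 (\<exists>x\<in>C. \<exists>y\<in>D. (x, y) \<in> parcs \<Gamma>)}\<rparr>"

text \<open>
  The internal product of the symmetric groups on the classes, as a set of permutations of
  the vertices.
\<close>

definition class_symmetries :: "'v pair_pre_digraph \<Rightarrow> ('v \<Rightarrow> 'v) set" where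
  "class_symmetries \<Gamma> = {f \<in> Bij (pverts \<Gamma>). \<forall>C\<in>neighbour_classes \<Gamma>. f ` C = C}"

definition induced_on_classes ::
    "'v pair_pre_digraph \<Rightarrow> ('v \<Rightarrow> 'v) \<Rightarrow> 'v set \<Rightarrow> 'v set" where
  "induced_on_classes \<Gamma> f = (\<lambda>C\<in>neighbour_classes \<Gamma>. f ` C)"

section \<open>Split extensions\<close>

definition split_extension :: "('a, 'b) monoid_scheme \<Rightarrow> 'a set \<Rightarrow> 'a set \<Rightarrow> bool" where
  "split_extension E A B \<longleftrightarrow>
     A \<lhd> E \<and> subgroup B E \<and> A \<inter> B = {\<one>\<^bsub>E\<^esub>} \<and> A <#>\<^bsub>E\<^esub> B = carrier E"

section \<open>The generating graph\<close>

definition generating_graph :: "('a, 'b) monoid_scheme \<Rightarrow> 'a pair_pre_digraph" where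
  "generating_graph G =
     \<lparr>pverts = carrier G,
      parcs = {(x, y). x \<in> carrier G \<and> y \<in> carrier G \<and> generate G {x, y} = carrier G}\<rparr>"

lemma generating_graph_pseudo_graph:
  assumes "finite (carrier G)"
  shows "pair_pseudo_graph (generating_graph G)"
proof
  have "parcs (generating_graph G) \<subseteq> carrier G \<times> carrier G"
    by (auto simp only: generating_graph_def pair_pre_digraph.simps)
  then show "finite (parcs (generating_graph G))"
    using assms by (blast intro: finite_subset)
  show "symmetric (with_proj (generating_graph G))"
    unfolding symmetric_def with_proj_simps
    by (rule symI) (simp add: generating_graph_def insert_commute)
qed (use assms in \<open>simp_all add: generating_graph_def split_beta\<close>)

lemma equiv_same_neighbours: "equiv (pverts \<Gamma>) (same_neighbours \<Gamma>)"
  by (rule equivI)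
    (simp_all add: refl_on_def sym_def trans_def same_neighbours_def subset_iff)

lemma (in pair_sym_digraph) reduced_graph_arc_iff:
  assumes C: "C \<in> neighbour_classes G" and D: "D \<in> neighbour_classes G"
    and "x \<in> C" "y \<in> D"
  shows "(C, D) \<in> parcs (reduced_graph G) \<longleftrightarrow> (x, y) \<in> parcs G"
proof
  have sym: "(v, u) \<in> parcs G" if "(u, v) \<in> parcs G" for u v
    using that pair_sym_arcs by (simp add: symmetric_def symD)
  have eq: "neighbours G u = neighbours G v"
    if "E \<in> neighbour_classes G" "u \<in> E" "v \<in> E" for u v E
  proof -
    have "(u, v) \<in> same_neighbours G"
      using that unfolding neighbour_classes_def
      by (intro in_quotient_imp_in_rel[OF equiv_same_neighbours, where X = E]) simp_all
    then show ?thesis by (simp add: same_neighbours_def)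
  qed
  have mem: "(u, v) \<in> parcs G \<longleftrightarrow> v \<in> neighbours G u" for u v
    using in_arcsD2[of u v] by (simp add: neighbours_def) blast
  assume "(C, D) \<in> parcs (reduced_graph G)"
  then obtain x' y' where x': "x' \<in> C" and y': "y' \<in> D" and "(x', y') \<in> parcs G"
    by (simp add: reduced_graph_def) blast
  then have "(x, y') \<in> parcs G"
    using eq[OF C x' \<open>x \<in> C\<close>] by (simp add: mem)
  then have "(y', x) \<in> parcs G" by (rule sym)
  then have "(y, x) \<in> parcs G"
    using eq[OF D y' \<open>y \<in> D\<close>] by (simp add: mem)
  then show "(x, y) \<in> parcs G" by (rule sym)
next
  assume "(x, y) \<in> parcs G"
  with assms show "(C, D) \<in> parcs (reduced_graph G)"
    by (simp add: reduced_graph_def) blast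
qed

lemma subgroup_graph_aut:
  "subgroup (carrier (graph_aut_group \<Gamma>)) (BijGroup (pverts \<Gamma>))"
proof -
  let ?V = "pverts \<Gamma>"
  interpret B: group "BijGroup ?V" by (rule group_BijGroup)
  show ?thesis
  proof (rule B.subgroupI)
    show "carrier (graph_aut_group \<Gamma>) \<noteq> {}"
      using id_Bij[of ?V] by (force simp: graph_aut_group_def)
    show "a \<otimes>\<^bsub>BijGroup ?V\<^esub> b \<in> carrier (graph_aut_group \<Gamma>)"
      if "a \<in> carrier (graph_aut_group \<Gamma>)" "b \<in> carrier (graph_aut_group \<Gamma>)" for a b
      using that Bij_imp_funcset[of b ?V]
      by (auto simp: graph_aut_group_def BijGroup_def compose_Bij compose_eq Pi_iff)
    show "inv\<^bsub>BijGroup ?V\<^esub> f \<in> carrier (graph_aut_group \<Gamma>)"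
      if "f \<in> carrier (graph_aut_group \<Gamma>)" for f
    proof -
      have f: "f \<in> Bij ?V" and arc: "\<And>u v. u \<in> ?V \<Longrightarrow> v \<in> ?V \<Longrightarrow>
          (f u, f v) \<in> parcs \<Gamma> \<longleftrightarrow> (u, v) \<in> parcs \<Gamma>"
        using that by (auto simp: graph_aut_group_def)
      have "f (inv_into ?V f u) = u" "inv_into ?V f u \<in> ?V" if "u \<in> ?V" for u
        using f that by (auto simp: Bij_def bij_betw_def f_inv_into_f inv_into_into)
      with arc show ?thesis
        by (auto simp: inv_BijGroup[OF f] graph_aut_group_def restrict_inv_into_Bij[OF f]) metis+
    qed
  qed (auto simp: graph_aut_group_def BijGroup_def)
qed

lemma group_graph_aut_group: "group (graph_aut_group \<Gamma>)"
proof -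
  have "group ((BijGroup (pverts \<Gamma>))\<lparr>carrier := carrier (graph_aut_group \<Gamma>)\<rparr>)"
    using subgroup_graph_aut group_BijGroup by (rule subgroup.subgroup_is_group)
  then show ?thesis by (simp add: graph_aut_group_def)
qed

end

theory Submission
  imports Defs "HOL-Library.Disjoint_Sets"
begin

text \<open>
  An automorphism maps \<open>\<equiv>\<close>-classes to \<open>\<equiv>\<close>-classes, so it acts on the reduced graph; the kernel
  of this action consists of the vertex permutations that fix every class, which are all
  automorphisms because adjacency depends on the classes only.  Numbering the elements of each
  class gives a bijection between any two classes of equal size, compatibly with composition.
  Moving classes along these bijections is a homomorphic section of the action, so its image
  is the complement.
\<close>

section \<open>Sections of homomorphisms, products of groups, symmetric groups\<close>

text \<open>Every \<open>x\<close> is the product of \<open>x\<close> times the inverse of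
  \<open>s (\<pi> x)\<close>, which \<open>\<pi>\<close> kills, and of \<open>s (\<pi> x)\<close>.
  An element of the image of \<open>s\<close> that \<open>\<pi>\<close> kills comes from the unit,
  so the two subgroups meet trivially. By the retraction property \<open>\<pi>\<close> and
  \<open>s\<close> are mutually inverse between the image of \<open>s\<close> and
  \<open>Q\<close>.\<close>

lemma split_extension_section:
  assumes "group_hom E Q \<pi>" and s: "s \<in> hom Q E"
    and retract: "\<And>q. q \<in> carrier Q \<Longrightarrow> \<pi> (s q) = q"
  shows "split_extension E (kernel E Q \<pi>) (s ` carrier Q)"
    and "\<pi> \<in> iso (E\<lparr>carrier := s ` carrier Q\<rparr>) Q"
proof -
  interpret \<pi>: group_hom E Q \<pi> by fact
  interpret s: group_hom Q E s using s by unfold_locales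
  have "kernel E Q \<pi> \<inter> s ` carrier Q = {\<one>\<^bsub>E\<^esub>}"
    using retract s.hom_one by (force simp: kernel_def)
  moreover have "kernel E Q \<pi> <#>\<^bsub>E\<^esub> s ` carrier Q = carrier E"
  proof
    show "kernel E Q \<pi> <#>\<^bsub>E\<^esub> s ` carrier Q \<subseteq> carrier E"
      by (auto simp: set_mult_def kernel_def)
    show "carrier E \<subseteq> kernel E Q \<pi> <#>\<^bsub>E\<^esub> s ` carrier Q"
    proof
      fix x assume x: "x \<in> carrier E"
      let ?b = "s (\<pi> x)"
      have "x \<otimes>\<^bsub>E\<^esub> inv\<^bsub>E\<^esub> ?b \<in> kernel E Q \<pi>" "?b \<in> s ` carrier Q"
        using x by (simp_all add: kernel_def retract)
      then have "(x \<otimes>\<^bsub>E\<^esub> inv\<^bsub>E\<^esub> ?b) \<otimes>\<^bsub>E\<^esub> ?b \<in> kernel E Q \<pi> <#>\<^bsub>E\<^esub> s ` carrier Q"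
        unfolding set_mult_def by blast
      then show "x \<in> kernel E Q \<pi> <#>\<^bsub>E\<^esub> s ` carrier Q"
        using x by (simp add: \<pi>.G.m_assoc)
    qed
  qed
  ultimately show "split_extension E (kernel E Q \<pi>) (s ` carrier Q)"
    unfolding split_extension_def
    by (intro conjI \<pi>.normal_kernel s.img_is_subgroup)
  show "\<pi> \<in> iso (E\<lparr>carrier := s ` carrier Q\<rparr>) Q"
  proof (rule isoI)
    show "\<pi> \<in> hom (E\<lparr>carrier := s ` carrier Q\<rparr>) Q"
      by (rule homI) auto
    show "bij_betw \<pi> (carrier (E\<lparr>carrier := s ` carrier Q\<rparr>)) (carrier Q)"
      by (rule bij_betw_byWitness[where f' = s]) (auto simp: retract)
  qed
qed

text \<open>Serves to pass from a product indexed by the set of classes to one indexed by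
  \<open>{1..n}\<close>. Substituting \<open>c\<close> for the index is undone by substituting its
  inverse.\<close>

lemma product_group_reindex:
  assumes c: "bij_betw c I J"
  shows "product_group J G \<cong> product_group I (\<lambda>i. G (c i))"
proof (rule is_isoI, rule isoI)
  let ?h = "\<lambda>x. \<lambda>i\<in>I. x (c i)"
  have cI: "c i \<in> J" if "i \<in> I" for i
    using c that by (rule bij_betw_apply)
  show "?h \<in> hom (product_group J G) (product_group I (\<lambda>i. G (c i)))"
    by (rule homI) (auto simp: cI PiE_iff fun_eq_iff)
  have inv: "c (inv_into I c j) = j" "inv_into I c j \<in> I" if "j \<in> J" for j
    using c that by (auto simp: bij_betw_def f_inv_into_f inv_into_into)
  have inv': "inv_into I c (c i) = i" if "i \<in> I" for i
    using c that by (simp add: bij_betw_def)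
  have "(\<lambda>j\<in>J. y (inv_into I c j)) \<in> (\<Pi>\<^sub>E j\<in>J. carrier (G j))"
    if "y \<in> (\<Pi>\<^sub>E i\<in>I. carrier (G (c i)))" for y
  proof (rule restrict_PiE_iff[THEN iffD2, rule_format])
    fix j assume "j \<in> J"
    \<comment> \<open>The value lies a priori in the factor at \<open>c (inv_into I c j)\<close>;
      the factors depend on the index, so this index has to be rewritten to
      \<open>j\<close>.\<close>
    with PiE_mem[OF that inv(2)] show "y (inv_into I c j) \<in> carrier (G j)"
      by (metis inv(1))
  qed
  then show "bij_betw ?h (carrier (product_group J G)) (carrier (product_group I (\<lambda>i. G (c i))))"
    by (intro bij_betw_byWitness[where f' = "\<lambda>y. \<lambda>j\<in>J. y (inv_into I c j)"])
      (auto simp: cI inv inv' PiE_iff fun_eq_iff extensional_def)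
qed

text \<open>Conjugation by a numbering \<open>h\<close> of \<open>S\<close>. The two groups treat
  points off the domain differently: elements of \<open>BijGroup S\<close> are undefined there,
  those of \<open>sym_group\<close> fix them. Hence the case distinction in \<open>?F\<close> and
  the restriction in \<open>?F'\<close>.\<close>

lemma BijGroup_iso_sym_group:
  assumes "finite S"
  shows "BijGroup S \<cong> sym_group (card S)"
proof -
  let ?T = "{1..card S}"
  obtain h where h: "bij_betw h S ?T"
    using finite_same_card_bij[of S ?T] assms by auto
  let ?h' = "inv_into S h"
  let ?F = "\<lambda>f i. if i \<in> ?T then h (f (?h' i)) else i"
  let ?F' = "\<lambda>p. \<lambda>x\<in>S. ?h' (p (h x))"
  have h': "bij_betw ?h' ?T S"
    using h by (rule bij_betw_inv_into)
  have hS: "h x \<in> ?T" "?h' (h x) = x" if "x \<in> S" for x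
    using h that by (auto simp: bij_betw_def)
  have hT: "?h' i \<in> S" "h (?h' i) = i" if "i \<in> ?T" for i
    using h that by (auto simp: bij_betw_def f_inv_into_f inv_into_into)
  have F: "?F f permutes ?T" if "f \<in> Bij S" for f
  proof (rule bij_imp_permutes)
    have "bij_betw (h \<circ> f \<circ> ?h') ?T ?T"
      using that h h' by (auto simp: Bij_def intro!: bij_betw_trans)
    then show "bij_betw (?F f) ?T ?T"
      by (rule bij_betw_cong[THEN iffD1, rotated]) simp
  qed auto
  have F': "?F' p \<in> Bij S" if "p permutes ?T" for p
  proof -
    have "bij_betw (?h' \<circ> p \<circ> h) S S"
      using permutes_imp_bij[OF that] h h' by (auto intro!: bij_betw_trans)
    then have "bij_betw (?F' p) S S"
      by (rule bij_betw_cong[THEN iffD1, rotated]) simp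
    then show ?thesis by (simp add: Bij_def)
  qed
  have "?F \<in> hom (BijGroup S) (sym_group (card S))"
  proof (rule homI)
    show "?F f \<in> carrier (sym_group (card S))" if "f \<in> carrier (BijGroup S)" for f
      using F that by (simp only: sym_group_carrier BijGroup_def partial_object.simps)
    show "?F (f \<otimes>\<^bsub>BijGroup S\<^esub> g) = ?F f \<otimes>\<^bsub>sym_group (card S)\<^esub> ?F g"
      if "f \<in> carrier (BijGroup S)" "g \<in> carrier (BijGroup S)" for f g
    proof
      have fg: "f \<in> Bij S" "g \<in> Bij S"
        using that by (simp_all add: BijGroup_def)
      fix i
      show "?F (f \<otimes>\<^bsub>BijGroup S\<^esub> g) i = (?F f \<otimes>\<^bsub>sym_group (card S)\<^esub> ?F g) i"
      proof (cases "i \<in> ?T")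
        case True
        then have "g (?h' i) \<in> S"
          using hT(1) Bij_imp_funcset[OF fg(2)] by blast
        with True show ?thesis
          using fg hS[of "g (?h' i)"] hT[of i]
          by (simp add: BijGroup_def sym_group_mult compose_eq)
      qed (auto simp: sym_group_mult)
    qed
  qed
  moreover have "bij_betw ?F (Bij S) {p. p permutes ?T}"
  proof (rule bij_betw_byWitness[where f' = ?F'])
    show "\<forall>f\<in>Bij S. ?F' (?F f) = f"
    proof (intro ballI ext)
      fix f x assume f: "f \<in> Bij S"
      show "?F' (?F f) x = f x"
      proof (cases "x \<in> S")
        case True
        with Bij_imp_funcset[OF f] have "f x \<in> S" by blast
        with True show ?thesis using hS by simp
      qed (use Bij_imp_extensional[OF f] in \<open>simp add: extensional_def\<close>)
    qed
    show "\<forall>p\<in>{p. p permutes ?T}. ?F (?F' p) = p"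
    proof (intro ballI ext)
      fix p i assume "p \<in> {p. p permutes ?T}"
      then have p: "p permutes ?T" by simp
      show "?F (?F' p) i = p i"
      proof (cases "i \<in> ?T")
        case True
        then have "p i \<in> ?T" using permutes_in_image[OF p] by blast
        with True show ?thesis using hT by (simp del: atLeastAtMost_iff)
      next
        case False
        with permutes_not_in[OF p False] show ?thesis by (simp only: if_False)
      qed
    qed
  qed (use F F' in auto)
  ultimately have "?F \<in> iso (BijGroup S) (sym_group (card S))"
    by (intro isoI) (simp_all add: BijGroup_def sym_group_def)
  then show ?thesis by (rule is_isoI)
qed

section \<open>Permutations compatible with a partition\<close>

text \<open>Blockwise constructions need the block of a point as a function \<open>b\<close>; its
  third property expresses that distinct blocks are disjoint.\<close>

lemma partition_on_blockE:
  assumes "partition_on V P"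
  obtains b where "\<And>x. x \<in> V \<Longrightarrow> b x \<in> P" "\<And>x. x \<in> V \<Longrightarrow> x \<in> b x"
    "\<And>x D. D \<in> P \<Longrightarrow> x \<in> D \<Longrightarrow> b x = D"
proof -
  have "\<exists>D. D \<in> P \<and> x \<in> D" if "x \<in> V" for x
    using assms that by (auto simp: partition_on_def)
  then obtain b where b: "\<And>x. x \<in> V \<Longrightarrow> b x \<in> P \<and> x \<in> b x" by metis
  have uniq: "b x = D" if "D \<in> P" "x \<in> D" for x D
    using b[of x] that partition_onD1[OF assms] disjointD[OF partition_onD2[OF assms], of "b x" D]
    by auto
  show thesis by (rule that[of b]) (simp_all add: b uniq)
qed

text \<open>A permutation that stabilises every block acts on the blocks independently: restriction
  cuts it into pieces, and arbitrary permutations of the blocks can be glued together again.\<close>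

lemma restrict_blocks_iso:
  assumes P: "partition_on V P"
  shows "(\<lambda>f. \<lambda>D\<in>P. restrict f D)
    \<in> iso ((BijGroup V)\<lparr>carrier := {f \<in> Bij V. \<forall>D\<in>P. f ` D = D}\<rparr>) (product_group P BijGroup)"
    (is "?R \<in> iso ((BijGroup V)\<lparr>carrier := ?A\<rparr>) _")
proof (rule isoI)
  obtain b where b: "\<And>x. x \<in> V \<Longrightarrow> b x \<in> P" "\<And>x. x \<in> V \<Longrightarrow> x \<in> b x"
    "\<And>x D. D \<in> P \<Longrightarrow> x \<in> D \<Longrightarrow> b x = D"
    using partition_on_blockE[OF P] by metis
  have sub: "D \<subseteq> V" if "D \<in> P" for D
    using P that by (auto simp: partition_on_def)
  have R: "restrict f D \<in> Bij D" if "f \<in> ?A" "D \<in> P" for f D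
  proof -
    have "inj_on f D"
      using that sub by (auto simp: Bij_def bij_betw_def intro: inj_on_subset)
    then show ?thesis using that by (simp add: Bij_def bij_betw_def)
  qed
  show "?R \<in> hom ((BijGroup V)\<lparr>carrier := ?A\<rparr>) (product_group P BijGroup)"
  proof (rule homI)
    show "?R f \<in> carrier (product_group P BijGroup)"
      if "f \<in> carrier ((BijGroup V)\<lparr>carrier := ?A\<rparr>)" for f
      using R that by (auto simp: BijGroup_def)
    fix f g
    assume "f \<in> carrier ((BijGroup V)\<lparr>carrier := ?A\<rparr>)"
      "g \<in> carrier ((BijGroup V)\<lparr>carrier := ?A\<rparr>)"
    then have fg: "f \<in> ?A" "g \<in> ?A" by simp_all
    have "restrict (compose V f g) D = compose D (restrict f D) (restrict g D)"
      if "D \<in> P" for D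
    proof
      fix x
      have "g x \<in> D" if "x \<in> D" using fg \<open>D \<in> P\<close> that by blast
      then show "restrict (compose V f g) D x = compose D (restrict f D) (restrict g D) x"
        using sub[OF \<open>D \<in> P\<close>] by (auto simp: compose_def)
    qed
    with fg R show "?R (f \<otimes>\<^bsub>(BijGroup V)\<lparr>carrier := ?A\<rparr>\<^esub> g)
        = ?R f \<otimes>\<^bsub>product_group P BijGroup\<^esub> ?R g"
      by (auto simp: BijGroup_def fun_eq_iff)
  qed
  \<comment> \<open>The gluing map: \<open>x\<close> is moved by the member of the family that
    belongs to its own block.\<close>
  let ?S = "\<lambda>g. \<lambda>x\<in>V. g (b x) x"
  have S: "?S g \<in> ?A" if g: "g \<in> (\<Pi>\<^sub>E D\<in>P. Bij D)" for g
  proof -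
    have gD: "bij_betw (g D) D D" if "D \<in> P" for D
      using g that by (auto simp: Bij_def PiE_iff)
    have img: "?S g ` D = D" if "D \<in> P" for D
    proof -
      have "?S g ` D = g D ` D"
        using that b(3) sub[OF that] by (intro image_cong) auto
      with gD[OF that] show ?thesis by (simp add: bij_betw_def)
    qed
    have "inj_on (?S g) V"
    proof (rule inj_onI)
      fix x y assume xy: "x \<in> V" "y \<in> V" "?S g x = ?S g y"
      \<comment> \<open>Values stay in the block of their argument, so equal values force equal
        blocks, and injectivity within one block remains.\<close>
      have "?S g x \<in> b x" "?S g y \<in> b y"
        using img b xy by blast+
      then have eq: "b x = b y" using b xy by metis
      have "g (b x) x = g (b x) y" using xy eq by simp
      moreover have "inj_on (g (b x)) (b x)"
        using gD b(1) xy(1) by (simp add: bij_betw_def)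
      moreover have "x \<in> b x" "y \<in> b x"
        using b(2)[OF xy(1)] b(2)[OF xy(2)] eq by simp_all
      ultimately show "x = y"
        by (metis inj_onD)
    qed
    moreover have "?S g ` \<Union>P = \<Union>P"
      unfolding image_Union using img by simp
    then have "?S g ` V = V"
      unfolding partition_onD1[OF P, symmetric] .
    ultimately show ?thesis
      using img by (auto simp: Bij_def bij_betw_def)
  qed
  have "bij_betw ?R ?A (\<Pi>\<^sub>E D\<in>P. Bij D)"
  proof (rule bij_betw_byWitness[where f' = ?S])
    show "\<forall>f\<in>?A. ?S (?R f) = f"
      using b by (auto simp: fun_eq_iff Bij_def extensional_def)
    show "\<forall>g\<in>(\<Pi>\<^sub>E D\<in>P. Bij D). ?R (?S g) = g"
    proof (intro ballI ext)
      fix g D x assume g: "g \<in> (\<Pi>\<^sub>E D\<in>P. Bij D)"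
      show "?R (?S g) D x = g D x"
      proof (cases "D \<in> P")
        case True
        with g have "g D \<in> extensional D" by (auto simp: Bij_def)
        with True show ?thesis
          using b(3) sub[OF True] by (auto simp: extensional_def)
      qed (use g in \<open>auto simp: PiE_iff extensional_def\<close>)
    qed
    show "?R ` ?A \<subseteq> (\<Pi>\<^sub>E D\<in>P. Bij D)" using R by auto
    show "?S ` (\<Pi>\<^sub>E D\<in>P. Bij D) \<subseteq> ?A" using S by blast
  qed
  then show "bij_betw ?R (carrier ((BijGroup V)\<lparr>carrier := ?A\<rparr>)) (carrier (product_group P BijGroup))"
    by (simp add: BijGroup_def)
qed

text \<open>The blocks are numbered once, independently of \<open>\<phi>\<close>, and
  \<open>s \<phi>\<close> moves each point to the point with the same number in the target block.
  Numbers are thus preserved by every lift, which is why lifts compose correctly.\<close>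

lemma block_permutations_lift:
  assumes P: "partition_on V P" and fin: "\<And>D. D \<in> P \<Longrightarrow> finite D"
  defines "W \<equiv> {\<phi> \<in> Bij P. \<forall>D\<in>P. card (\<phi> D) = card D}"
  shows "\<exists>s \<in> hom ((BijGroup P)\<lparr>carrier := W\<rparr>) (BijGroup V). \<forall>\<phi>\<in>W. \<forall>D\<in>P. s \<phi> ` D = \<phi> D"
proof -
  obtain b where b: "\<And>x. x \<in> V \<Longrightarrow> b x \<in> P" "\<And>x. x \<in> V \<Longrightarrow> x \<in> b x"
    "\<And>x D. D \<in> P \<Longrightarrow> x \<in> D \<Longrightarrow> b x = D"
    using partition_on_blockE[OF P] by metis
  have sub: "D \<subseteq> V" if "D \<in> P" for D
    using P that by (auto simp: partition_on_def)
  have "\<exists>e. bij_betw e D {0..<card D}" if "D \<in> P" for D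
    using ex_bij_betw_finite_nat[OF fin[OF that]] .
  then obtain e where e: "\<And>D. D \<in> P \<Longrightarrow> bij_betw (e D) D {0..<card D}" by metis
  \<comment> \<open>\<open>t C D\<close> matches points of \<open>C\<close> and \<open>D\<close>
    with equal numbers; for blocks of equal size both numberings have the same range.\<close>
  define t where "t C D x = inv_into D (e D) (e C x)" for C D x
  define s where "s \<phi> = (\<lambda>x\<in>V. t (b x) (\<phi> (b x)) x)" for \<phi>
  note W_def[simp]
  have t: "bij_betw (t C D) C D" if "C \<in> P" "D \<in> P" "card C = card D" for C D
    unfolding t_def
    using bij_betw_trans[OF e[OF that(1)], of "inv_into D (e D)" D]
      bij_betw_inv_into[OF e[OF that(2)]] that(3) by (simp add: comp_def)
  \<comment> \<open>Passing through \<open>D\<close> keeps the number of \<open>x\<close>. This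
    cocycle rule yields the multiplicativity of \<open>s\<close>.\<close>
  have t_trans: "t D E (t C D x) = t C E x"
    if "C \<in> P" "D \<in> P" "card C = card D" "x \<in> C" for C D E x
  proof -
    have "e C x \<in> e D ` D"
      using e[OF that(1)] e[OF that(2)] that by (auto simp: bij_betw_def)
    then show ?thesis by (simp add: t_def f_inv_into_f)
  qed
  have \<phi>P: "\<phi> D \<in> P" if "\<phi> \<in> Bij P" "D \<in> P" for \<phi> D
    using Bij_imp_funcset[OF that(1)] that(2) by blast
  have s_img: "s \<phi> ` D = \<phi> D" if "\<phi> \<in> W" "D \<in> P" for \<phi> D
  proof -
    have "s \<phi> ` D = t D (\<phi> D) ` D"
      using that(2) b(3) sub[OF that(2)] by (intro image_cong) (auto simp: s_def)
    also have "\<dots> = \<phi> D"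
      using t[of D "\<phi> D"] that \<phi>P by (simp add: bij_betw_def)
    finally show ?thesis .
  qed
  have s_Bij: "s \<phi> \<in> Bij V" if W: "\<phi> \<in> W" for \<phi>
  proof -
    have "inj_on (s \<phi>) V"
    proof (rule inj_onI)
      fix x y assume xy: "x \<in> V" "y \<in> V" "s \<phi> x = s \<phi> y"
      \<comment> \<open>The common value determines its block, so \<open>\<phi>\<close> agrees on
        the blocks of \<open>x\<close> and \<open>y\<close>; injectivity of \<open>\<phi>\<close>
        identifies these, and that of \<open>t\<close> then identifies the points.\<close>
      have "s \<phi> x \<in> \<phi> (b x)" "s \<phi> y \<in> \<phi> (b y)"
        using s_img[OF W] b xy by blast+
      moreover have "\<phi> (b x) \<in> P" "\<phi> (b y) \<in> P"
        using W \<phi>P b(1) xy by simp_all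
      ultimately have "\<phi> (b x) = \<phi> (b y)"
        using b(3) xy(3) by metis
      then have eq: "b x = b y"
        using W b(1) xy by (auto simp: Bij_def bij_betw_def dest: inj_onD)
      have "inj_on (t (b x) (\<phi> (b x))) (b x)"
        using t[of "b x" "\<phi> (b x)"] W \<phi>P b(1) xy by (simp add: bij_betw_def)
      with xy eq b(2) show "x = y"
        by (auto simp: s_def dest: inj_onD)
    qed
    moreover have "s \<phi> ` V = V"
    proof -
      have V: "\<Union>P = V" using P by (simp add: partition_on_def)
      have "s \<phi> ` \<Union>P = \<Union>(\<phi> ` P)"
        unfolding image_Union using s_img[OF W] by simp
      also have "\<phi> ` P = P" using W by (simp add: Bij_def bij_betw_def)
      finally show ?thesis by (simp add: V)
    qed
    ultimately show ?thesis
      by (simp add: Bij_def bij_betw_def s_def)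
  qed
  have "s \<in> hom ((BijGroup P)\<lparr>carrier := W\<rparr>) (BijGroup V)"
  proof (rule homI)
    show "s \<phi> \<in> carrier (BijGroup V)" if "\<phi> \<in> carrier ((BijGroup P)\<lparr>carrier := W\<rparr>)" for \<phi>
      using s_Bij that by (simp add: BijGroup_def)
    fix \<phi> \<psi>
    assume "\<phi> \<in> carrier ((BijGroup P)\<lparr>carrier := W\<rparr>)"
      "\<psi> \<in> carrier ((BijGroup P)\<lparr>carrier := W\<rparr>)"
    then have W: "\<phi> \<in> W" "\<psi> \<in> W" by simp_all
    have "s (compose P \<phi> \<psi>) = compose V (s \<phi>) (s \<psi>)"
    proof
      fix x
      show "s (compose P \<phi> \<psi>) x = compose V (s \<phi>) (s \<psi>) x"
      proof (cases "x \<in> V")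
        case True
        note x = b(1)[OF True] b(2)[OF True]
        have y: "s \<psi> x \<in> \<psi> (b x)" using s_img[OF W(2)] x by blast
        have P': "\<psi> (b x) \<in> P" using \<phi>P W x by simp
        \<comment> \<open>The outer lift looks up the block of \<open>s \<psi> x\<close>, which is
          \<open>\<psi> (b x)\<close>.\<close>
        have "s \<phi> (s \<psi> x) = t (\<psi> (b x)) (\<phi> (\<psi> (b x))) (s \<psi> x)"
          using b(3)[OF P' y] sub[OF P'] y by (simp add: s_def[of \<phi>] subset_iff)
        also have "\<dots> = t (b x) (\<phi> (\<psi> (b x))) x"
          using t_trans[of "b x" "\<psi> (b x)"] x P' W True by (simp add: s_def)
        also have "\<dots> = s (compose P \<phi> \<psi>) x"
          using True x by (simp add: compose_def s_def)
        finally show ?thesis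
          using True by (simp add: compose_def)
      qed (simp add: compose_def s_def)
    qed
    with W s_Bij show "s (\<phi> \<otimes>\<^bsub>(BijGroup P)\<lparr>carrier := W\<rparr>\<^esub> \<psi>) = s \<phi> \<otimes>\<^bsub>BijGroup V\<^esub> s \<psi>"
      by (simp add: BijGroup_def)
  qed
  with s_img show ?thesis by blast
qed

section \<open>The action on the classes\<close>

lemma partition_on_neighbour_classes: "partition_on (pverts \<Gamma>) (neighbour_classes \<Gamma>)"
  unfolding neighbour_classes_def by (rule partition_on_quotient[OF equiv_same_neighbours])

lemma neighbour_classes_subset: "D \<in> neighbour_classes \<Gamma> \<Longrightarrow> D \<subseteq> pverts \<Gamma>"
  using partition_on_neighbour_classes[of \<Gamma>] by (auto simp: partition_on_def)

lemma carrier_graph_autD: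
  assumes "f \<in> carrier (graph_aut_group \<Gamma>)"
  shows "f \<in> Bij (pverts \<Gamma>)"
    and "u \<in> pverts \<Gamma> \<Longrightarrow> v \<in> pverts \<Gamma> \<Longrightarrow> (f u, f v) \<in> parcs \<Gamma> \<longleftrightarrow> (u, v) \<in> parcs \<Gamma>"
  using assms by (simp_all add: graph_aut_group_def)

lemma graph_aut_neighbours:
  assumes f: "f \<in> carrier (graph_aut_group \<Gamma>)" and x: "x \<in> pverts \<Gamma>"
  shows "neighbours \<Gamma> (f x) = f ` neighbours \<Gamma> x"
proof -
  have "f ` pverts \<Gamma> = pverts \<Gamma>"
    using carrier_graph_autD(1)[OF f] by (simp add: Bij_def bij_betw_def)
  then show ?thesis
    using carrier_graph_autD(2)[OF f x] by (force simp: neighbours_def)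
qed

text \<open>Neighbourhoods are carried to neighbourhoods, and taking images under an injective map
  preserves and reflects equality of sets of vertices. Surjectivity of \<open>f\<close> ensures that
  the whole target class is reached.\<close>

lemma graph_aut_same_neighbours:
  assumes f: "f \<in> carrier (graph_aut_group \<Gamma>)" and x: "x \<in> pverts \<Gamma>"
  shows "f ` (same_neighbours \<Gamma> `` {x}) = same_neighbours \<Gamma> `` {f x}"
proof -
  have bij: "inj_on f (pverts \<Gamma>)" "f ` pverts \<Gamma> = pverts \<Gamma>"
    using carrier_graph_autD(1)[OF f] by (simp_all add: Bij_def bij_betw_def)
  have "neighbours \<Gamma> (f x) = neighbours \<Gamma> (f y) \<longleftrightarrow> neighbours \<Gamma> x = neighbours \<Gamma> y"
    if "y \<in> pverts \<Gamma>" for y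
    unfolding graph_aut_neighbours[OF f x] graph_aut_neighbours[OF f that]
    by (rule inj_on_image_eq_iff[OF bij(1)]) (auto simp: neighbours_def)
  then have "f ` {y \<in> pverts \<Gamma>. neighbours \<Gamma> x = neighbours \<Gamma> y} =
      {z \<in> f ` pverts \<Gamma>. neighbours \<Gamma> (f x) = neighbours \<Gamma> z}"
    by auto
  moreover have "same_neighbours \<Gamma> `` {z} = {y \<in> pverts \<Gamma>. neighbours \<Gamma> z = neighbours \<Gamma> y}"
    if "z \<in> pverts \<Gamma>" for z
    using that by (auto simp: same_neighbours_def)
  moreover have "f x \<in> pverts \<Gamma>" using bij(2) x by blast
  ultimately show ?thesis using bij(2) x by simp
qed

lemma graph_aut_image_class:
  assumes f: "f \<in> carrier (graph_aut_group \<Gamma>)" and C: "C \<in> neighbour_classes \<Gamma>"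
  shows "f ` C \<in> neighbour_classes \<Gamma>"
proof -
  obtain x where x: "x \<in> pverts \<Gamma>" "C = same_neighbours \<Gamma> `` {x}"
    using C unfolding neighbour_classes_def by (rule quotientE)
  moreover have "f x \<in> pverts \<Gamma>"
    using Bij_imp_funcset[OF carrier_graph_autD(1)[OF f]] x(1) by blast
  ultimately show ?thesis
    by (simp add: graph_aut_same_neighbours[OF f] neighbour_classes_def quotientI)
qed

lemma induced_on_classes_Bij:
  assumes f: "f \<in> carrier (graph_aut_group \<Gamma>)"
  shows "induced_on_classes \<Gamma> f \<in> Bij (neighbour_classes \<Gamma>)"
proof -
  have bij: "inj_on f (pverts \<Gamma>)" "f ` pverts \<Gamma> = pverts \<Gamma>"
    using carrier_graph_autD(1)[OF f] by (simp_all add: Bij_def bij_betw_def)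
  have "inj_on ((`) f) (neighbour_classes \<Gamma>)"
    using inj_on_image_eq_iff[OF bij(1)] neighbour_classes_subset by (metis inj_onI)
  moreover have "(`) f ` neighbour_classes \<Gamma> = neighbour_classes \<Gamma>"
  proof
    show "neighbour_classes \<Gamma> \<subseteq> (`) f ` neighbour_classes \<Gamma>"
    proof
      fix C assume "C \<in> neighbour_classes \<Gamma>"
      \<comment> \<open>The representative is sought in the image of \<open>f\<close>, which is the
        whole vertex set, so that it can be pulled back to a vertex \<open>y\<close>.\<close>
      then obtain x where "x \<in> f ` pverts \<Gamma>" "C = same_neighbours \<Gamma> `` {x}"
        unfolding bij(2) neighbour_classes_def by (rule quotientE)
      then obtain y where y: "y \<in> pverts \<Gamma>" "C = same_neighbours \<Gamma> `` {f y}" by blast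
      then have "C = f ` (same_neighbours \<Gamma> `` {y})"
        by (simp add: graph_aut_same_neighbours[OF f])
      with y(1) show "C \<in> (`) f ` neighbour_classes \<Gamma>"
        by (auto simp: neighbour_classes_def intro: quotientI)
    qed
  qed (use graph_aut_image_class[OF f] in blast)
  ultimately show ?thesis
    by (simp add: induced_on_classes_def Bij_def bij_betw_def cong: image_cong_simp)
qed

text \<open>The target is the full group of permutations of the classes, already known to be a
  group; the weighted automorphism group is later recognised as the image.\<close>

lemma induced_on_classes_hom:
  "induced_on_classes \<Gamma> \<in> hom (graph_aut_group \<Gamma>) (BijGroup (neighbour_classes \<Gamma>))"
proof (rule homI)
  show "induced_on_classes \<Gamma> f \<in> carrier (BijGroup (neighbour_classes \<Gamma>))"
    if "f \<in> carrier (graph_aut_group \<Gamma>)" for f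
    using induced_on_classes_Bij[OF that] by (simp add: BijGroup_def)
  fix f g
  assume f: "f \<in> carrier (graph_aut_group \<Gamma>)" and g: "g \<in> carrier (graph_aut_group \<Gamma>)"
  have mult: "f \<otimes>\<^bsub>graph_aut_group \<Gamma>\<^esub> g = compose (pverts \<Gamma>) f g"
    using carrier_graph_autD(1)[OF f] carrier_graph_autD(1)[OF g]
    by (simp add: graph_aut_group_def BijGroup_def)
  have img: "compose (pverts \<Gamma>) f g ` C = f ` g ` C" if "C \<in> neighbour_classes \<Gamma>" for C
    unfolding image_image
    using neighbour_classes_subset[OF that] by (intro image_cong) (auto simp: compose_eq)
  show "induced_on_classes \<Gamma> (f \<otimes>\<^bsub>graph_aut_group \<Gamma>\<^esub> g) =
      induced_on_classes \<Gamma> f \<otimes>\<^bsub>BijGroup (neighbour_classes \<Gamma>)\<^esub> induced_on_classes \<Gamma> g"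
    using induced_on_classes_Bij[OF f] induced_on_classes_Bij[OF g]
    by (simp add: mult BijGroup_def)
      (auto simp: fun_eq_iff induced_on_classes_def compose_def[of "neighbour_classes \<Gamma>"]
        img graph_aut_image_class[OF g])
qed

section \<open>Adjacency and weights on the reduced graph\<close>

text \<open>Adjacency of vertices can be read off from their classes. This serves twice: for maps
  fixing every class and for the lifts of automorphisms of the reduced graph.\<close>

lemma (in pair_sym_digraph) arc_image_iff:
  assumes f: "\<And>C D. C \<in> neighbour_classes G \<Longrightarrow> D \<in> neighbour_classes G \<Longrightarrow>
      f ` C \<in> neighbour_classes G \<and>
      ((f ` C, f ` D) \<in> parcs (reduced_graph G) \<longleftrightarrow> (C, D) \<in> parcs (reduced_graph G))"
    and u: "u \<in> pverts G" and v: "v \<in> pverts G"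
  shows "(f u, f v) \<in> parcs G \<longleftrightarrow> (u, v) \<in> parcs G"
proof -
  obtain C D where C: "C \<in> neighbour_classes G" "u \<in> C" and D: "D \<in> neighbour_classes G" "v \<in> D"
    using u v unfolding partition_onD1[OF partition_on_neighbour_classes] by blast
  have "(f u, f v) \<in> parcs G \<longleftrightarrow> (f ` C, f ` D) \<in> parcs (reduced_graph G)"
    using C D f by (intro reduced_graph_arc_iff[symmetric]) blast+
  also have "\<dots> \<longleftrightarrow> (C, D) \<in> parcs (reduced_graph G)"
    using C D f by blast
  also have "\<dots> \<longleftrightarrow> (u, v) \<in> parcs G"
    using C D by (intro reduced_graph_arc_iff)
  finally show ?thesis .
qed

lemma (in pair_sym_digraph) class_symmetries_graph_aut:
  "class_symmetries G \<subseteq> carrier (graph_aut_group G)"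
  by (auto simp: class_symmetries_def graph_aut_group_def arc_image_iff)

lemma carrier_weighted_graph_aut_reduced:
  "carrier (weighted_graph_aut_group (reduced_graph \<Gamma>) card) =
    {\<phi> \<in> Bij (neighbour_classes \<Gamma>).
      (\<forall>C\<in>neighbour_classes \<Gamma>. \<forall>D\<in>neighbour_classes \<Gamma>.
        (\<phi> C, \<phi> D) \<in> parcs (reduced_graph \<Gamma>) \<longleftrightarrow> (C, D) \<in> parcs (reduced_graph \<Gamma>)) \<and>
      (\<forall>D\<in>neighbour_classes \<Gamma>. card (\<phi> D) = card D)}"
  by (auto simp: weighted_graph_aut_group_def graph_aut_group_def reduced_graph_def)

lemma (in pair_sym_digraph) induced_on_classes_weighted:
  assumes f: "f \<in> carrier (graph_aut_group G)"
  shows "induced_on_classes G f \<in> carrier (weighted_graph_aut_group (reduced_graph G) card)"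
proof -
  have "inj_on f C" if "C \<in> neighbour_classes G" for C
    using carrier_graph_autD(1)[OF f] neighbour_classes_subset[OF that]
    by (auto simp: Bij_def bij_betw_def intro: inj_on_subset)
  moreover have "(f ` C, f ` D) \<in> parcs (reduced_graph G) \<longleftrightarrow> (C, D) \<in> parcs (reduced_graph G)"
    if C: "C \<in> neighbour_classes G" and D: "D \<in> neighbour_classes G" for C D
  proof -
    \<comment> \<open>Nonempty classes have representatives, which translate arcs of the reduced
      graph into arcs of \<open>G\<close> and back.\<close>
    have "C \<noteq> {}" "D \<noteq> {}"
      using C D partition_on_neighbour_classes[of G] by (auto simp: partition_on_def)
    then obtain x y where xy: "x \<in> C" "y \<in> D" by blast
    have "(f ` C, f ` D) \<in> parcs (reduced_graph G) \<longleftrightarrow> (f x, f y) \<in> parcs G"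
      using xy C D by (intro reduced_graph_arc_iff graph_aut_image_class[OF f]) auto
    also have "\<dots> \<longleftrightarrow> (x, y) \<in> parcs G"
      using xy neighbour_classes_subset C D by (intro carrier_graph_autD(2)[OF f]) blast+
    also have "\<dots> \<longleftrightarrow> (C, D) \<in> parcs (reduced_graph G)"
      using xy C D by (intro reduced_graph_arc_iff[symmetric])
    finally show ?thesis .
  qed
  ultimately show ?thesis
    using induced_on_classes_Bij[OF f]
    by (simp add: carrier_weighted_graph_aut_reduced induced_on_classes_def card_image)
qed

section \<open>The split extension\<close>

text \<open>Stated for any finite symmetric graph, loops allowed; here \<open>G\<close> is the
  graph. The complement \<open>H\<close> is the image of the section \<open>s\<close> obtained from
  numbering the classes.\<close>

lemma (in pair_pseudo_graph) graph_aut_split_extension: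
  "\<exists>H. split_extension (graph_aut_group G) (class_symmetries G) H \<and>
     induced_on_classes G \<in> iso ((graph_aut_group G)\<lparr>carrier := H\<rparr>)
       (weighted_graph_aut_group (reduced_graph G) card)"
proof -
  let ?E = "graph_aut_group G" and ?P = "neighbour_classes G" and ?\<pi> = "induced_on_classes G"
  let ?Q = "weighted_graph_aut_group (reduced_graph G) card"
  have Q: "?Q = (BijGroup ?P)\<lparr>carrier := carrier ?Q\<rparr>"
    by (simp add: weighted_graph_aut_group_def graph_aut_group_def reduced_graph_def)
  interpret E: group ?E by (rule group_graph_aut_group)
  interpret \<pi>: group_hom ?E "BijGroup ?P" ?\<pi>
    by (simp add: group_hom_def group_hom_axioms_def group_BijGroup E.is_group
        induced_on_classes_hom)
  have fin: "finite D" if "D \<in> ?P" for D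
    using neighbour_classes_subset[OF that] pair_finite_verts by (rule finite_subset)
  obtain s where
    s: "s \<in> hom ((BijGroup ?P)\<lparr>carrier := {\<phi> \<in> Bij ?P. \<forall>D\<in>?P. card (\<phi> D) = card D}\<rparr>)
      (BijGroup (pverts G))"
    and img: "\<forall>\<phi>\<in>{\<phi> \<in> Bij ?P. \<forall>D\<in>?P. card (\<phi> D) = card D}. \<forall>D\<in>?P. s \<phi> ` D = \<phi> D"
    using block_permutations_lift[OF partition_on_neighbour_classes fin] by blast
  have s_aut: "s \<phi> \<in> carrier ?E" if \<phi>: "\<phi> \<in> carrier ?Q" for \<phi>
  proof -
    have W: "\<phi> \<in> Bij ?P" "\<forall>D\<in>?P. card (\<phi> D) = card D"
      and arcs: "\<And>C D. C \<in> ?P \<Longrightarrow> D \<in> ?P \<Longrightarrow>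
        (\<phi> C, \<phi> D) \<in> parcs (reduced_graph G) \<longleftrightarrow> (C, D) \<in> parcs (reduced_graph G)"
      using \<phi> by (simp_all add: carrier_weighted_graph_aut_reduced)
    have "s \<phi> \<in> Bij (pverts G)"
      using hom_carrier[OF s] W by (auto simp: BijGroup_def)
    moreover have "(s \<phi> u, s \<phi> v) \<in> parcs G \<longleftrightarrow> (u, v) \<in> parcs G"
      if "u \<in> pverts G" "v \<in> pverts G" for u v
      using that arcs Bij_imp_funcset[OF W(1)]
      by (intro arc_image_iff) (auto simp: img W)
    ultimately show ?thesis by (simp add: graph_aut_group_def)
  qed
  have retract: "?\<pi> (s \<phi>) = \<phi>" if "\<phi> \<in> carrier ?Q" for \<phi>
    using that img Bij_imp_extensional[of \<phi> ?P]
    by (auto simp: carrier_weighted_graph_aut_reduced induced_on_classes_def fun_eq_iff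
        extensional_def)
  \<comment> \<open>As the image of a homomorphism the carrier of \<open>?Q\<close> is a subgroup of
    the permutations of the classes, so \<open>?Q\<close> is a group; surjectivity comes from the
    lifts.\<close>
  have "?\<pi> ` carrier ?E = carrier ?Q"
    using induced_on_classes_weighted s_aut retract by force
  then have "subgroup (carrier ?Q) (BijGroup ?P)"
    using \<pi>.img_is_subgroup by simp
  then have "group ?Q"
    by (subst Q) (rule subgroup.subgroup_is_group[OF _ group_BijGroup])
  moreover have "?\<pi> \<in> hom ?E ?Q"
    using induced_on_classes_hom[of G] induced_on_classes_weighted
    by (subst Q) (auto simp: hom_def)
  ultimately have hom: "group_hom ?E ?Q ?\<pi>"
    by (simp add: group_hom_def group_hom_axioms_def E.is_group)
  have s_hom: "s \<in> hom ?Q ?E"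
  proof (rule homI)
    fix \<phi> \<psi> assume "\<phi> \<in> carrier ?Q" "\<psi> \<in> carrier ?Q"
    then show "s (\<phi> \<otimes>\<^bsub>?Q\<^esub> \<psi>) = s \<phi> \<otimes>\<^bsub>?E\<^esub> s \<psi>"
      using hom_mult[OF s, of \<phi> \<psi>]
      by (subst Q) (simp add: carrier_weighted_graph_aut_reduced graph_aut_group_def)
  qed (rule s_aut)
  have one: "\<one>\<^bsub>?Q\<^esub> = (\<lambda>D\<in>?P. D)"
    by (subst Q) (simp add: BijGroup_def)
  \<comment> \<open>Acting trivially on the classes means fixing each of them as a set; conversely
    every class symmetry is an automorphism and so lies in the kernel.\<close>
  have kernel: "kernel ?E ?Q ?\<pi> = class_symmetries G"
  proof -
    have "?\<pi> f = \<one>\<^bsub>?Q\<^esub> \<longleftrightarrow> (\<forall>D\<in>?P. f ` D = D)" for f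
      unfolding one induced_on_classes_def fun_eq_iff by auto
    with class_symmetries_graph_aut carrier_graph_autD(1) show ?thesis
      by (auto simp: kernel_def class_symmetries_def)
  qed
  show ?thesis
    using split_extension_section[where s = s, OF hom s_hom retract] unfolding kernel by blast
qed

text \<open>The explicit restriction map shows that the factors of the normal subgroup act on the
  classes themselves, which an abstract isomorphism with a product of symmetric groups would leave
  open.\<close>

theorem theorem5p2:
  fixes G :: "('a, 'b) monoid_scheme" and n :: nat and C :: "nat \<Rightarrow> 'a set" and k :: "nat \<Rightarrow> nat"
  assumes "group G" and "finite (carrier G)"
    and "bij_betw C {1..n} (neighbour_classes (generating_graph G))"
    and "\<And>i. i \<in> {1..n} \<Longrightarrow> card (C i) = k i"
  defines "\<Gamma> \<equiv> generating_graph G"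
  shows "(\<lambda>f. \<lambda>D\<in>neighbour_classes \<Gamma>. restrict f D)
           \<in> iso ((graph_aut_group \<Gamma>)\<lparr>carrier := class_symmetries \<Gamma>\<rparr>)
                 (product_group (neighbour_classes \<Gamma>) BijGroup) \<and>
         (graph_aut_group \<Gamma>)\<lparr>carrier := class_symmetries \<Gamma>\<rparr>
           \<cong> product_group {1..n} (\<lambda>i. sym_group (k i)) \<and>
         (\<exists>H. split_extension (graph_aut_group \<Gamma>) (class_symmetries \<Gamma>) H \<and>
              induced_on_classes \<Gamma>
                \<in> iso ((graph_aut_group \<Gamma>)\<lparr>carrier := H\<rparr>)
                      (weighted_graph_aut_group (reduced_graph \<Gamma>) card))"
proof (intro conjI)
  interpret \<Gamma>: pair_pseudo_graph \<Gamma>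
    unfolding \<Gamma>_def using assms(2) by (rule generating_graph_pseudo_graph)
  let ?P = "neighbour_classes \<Gamma>"
  let ?A = "(graph_aut_group \<Gamma>)\<lparr>carrier := class_symmetries \<Gamma>\<rparr>"
  have A: "?A = (BijGroup (pverts \<Gamma>))\<lparr>carrier := {f \<in> Bij (pverts \<Gamma>). \<forall>D\<in>?P. f ` D = D}\<rparr>"
    by (simp add: graph_aut_group_def class_symmetries_def)
  show iso: "(\<lambda>f. \<lambda>D\<in>?P. restrict f D) \<in> iso ?A (product_group ?P BijGroup)"
    unfolding A by (rule restrict_blocks_iso[OF partition_on_neighbour_classes])
  have C: "bij_betw C {1..n} ?P" unfolding \<Gamma>_def by (rule assms(3))
  \<comment> \<open>The abstract form follows by numbering the classes through \<open>C\<close> and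
    then the elements of each class.\<close>
  have "?A \<cong> product_group ?P BijGroup"
    using iso by (rule is_isoI)
  also have "product_group ?P BijGroup \<cong> product_group {1..n} (\<lambda>i. BijGroup (C i))"
    using C by (rule product_group_reindex)
  also have "\<dots> \<cong> product_group {1..n} (\<lambda>i. sym_group (k i))"
  proof (rule iso_product_groupI)
    fix i assume i: "i \<in> {1..n}"
    have "finite (C i)"
      using neighbour_classes_subset[OF bij_betw_apply[OF C i]] \<Gamma>.pair_finite_verts
      by (rule finite_subset)
    then show "BijGroup (C i) \<cong> sym_group (k i)"
      using BijGroup_iso_sym_group[of "C i"] assms(4)[OF i] by simp
  qed (simp_all add: group_BijGroup sym_group_is_group)
  finally show "?A \<cong> product_group {1..n} (\<lambda>i. sym_group (k i))" .
  show "\<exists>H. split_extension (graph_aut_group \<Gamma>) (class_symmetries \<Gamma>) H \<and>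
      induced_on_classes \<Gamma> \<in> iso ((graph_aut_group \<Gamma>)\<lparr>carrier := H\<rparr>)
        (weighted_graph_aut_group (reduced_graph \<Gamma>) card)"
    by (rule \<Gamma>.graph_aut_split_extension)
qed

end
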